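(* Let $(L,[-,-]_L,\delta)$ be an InvDer Lie algebra over $\mathbb{K}$ and let $(\mu_t,\delta_t)$, with $\mu_t=\sum_{i\ge0}\mu_it^i$ and $\delta_t=\sum_{i\ge0}\delta_it^i$, be a one-parameter formal deformation of it. Then $(\mu_1,\delta_1,\delta_1)$ is a $2$-cocycle of the InvDer Lie algebra $(L,[-,-]_L,\delta)$ with coefficients in the adjoint representation $(L;\mathrm{ad},\delta)$, i.e. $\mathfrak{D}^2_{\mathrm{InvDer}}(\mu_1,\delta_1,\delta_1)=0$.
   Context: $\mathbb{K}$ is a field of characteristic $0$; all vector spaces and algebras are over $\mathbb{K}$. A derivation of a Lie algebra $(L,[-,-]_L)$ is a linear map $\delta:L\to L$ with $\delta[x,y]_L=[\delta x,y]_L+[x,\delta y]_L$ for all $x,y\in L$. An Inv-derivation is an invertible derivation $\delta$ such that $[\delta x,\delta y]_L=\delta^2[x,y]_L$ for all $x,y\in L$. An InvDer Lie algebra $(L,[-,-]_L,\delta)$ is a Lie algebra equipped with an Inv-derivation $\delta$. Formal deformations: $L[[t]]$ is the space of formal power series $\sum_{i\ge0}x_it^i$ with $x_i\in L$. A one-parameter formal deformation of $(L,[-,-]_L,\delta)$ is a pair $(\mu_t,\delta_t)$ consisting of a $\mathbb{K}[[t]]$-bilinear map $\mu_t=\sum_{i\ge0}\mu_it^i:L[[t]]\times L[[t]]\to L[[t]]$ and a $\mathbb{K}[[t]]$-linear map $\delta_t=\sum_{i\ge0}\delta_it^i:L[[t]]\to L[[t]]$, where each $\mu_i:L\times L\to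 L$ is a skew-symmetric $\mathbb{K}$-bilinear map and each $\delta_i:L\to L$ is $\mathbb{K}$-linear, $\mu_0=[-,-]_L$, $\delta_0=\delta$, and for all $x,y,z\in L$ $$\mu_t(x,\mu_t(y,z))+\mu_t(y,\mu_t(z,x))+\mu_t(z,\mu_t(x,y))=0,$$ $$\delta_t\mu_t(x,y)-\mu_t(\delta_tx,y)-\mu_t(x,\delta_ty)=0,$$ $$\delta_t\delta_t\,\mu_t(x,y)-\mu_t(\delta_tx,\delta_ty)=0.$$ Cohomology with coefficients in the adjoint representation $(L;\mathrm{ad},\delta)$, i.e. $V=L$, $\rho(x)(y)=\mathrm{ad}(x)(y)=[x,y]_L$, $\delta_V=\delta$: put $C^n(L;L)=\mathrm{Hom}(\wedge^nL,L)$ and let $\partial^n_{\mathrm{CE}}:C^n(L;L)\to C^{n+1}(L;L)$ be the Chevalley–Eilenberg operator $$\partial^n_{\mathrm{CE}}(f)(x_1,\dots,x_{n+1})=\sum_{i=1}^{n+1}(-1)^{i+1}[x_i,f(x_1,\dots,\hat{x}_i,\dots,x_{n+1})]_L+\sum_{1\le i<j\le n+1}(-1)^{i+j}f([x_i,x_j]_L,x_1,\dots,\hat{x}_i,\dots,\hat{x}_j,\dots,x_{n+1}).$$ A $2$-cochain is a triple $(f,g,h)\in C^2(L;L)\oplus C^1(L;L)\oplus C^1(L;L)$; it is a $2$-cocycle if $\mathfrak{D}^2_{\mathrm{InvDer}}(f,g,h)=0$, where $$\mathfrak{D}^2_{\mathrm{InvDer}}(f,g,h)=(\partial^2_{\mathrm{CE}}(f),\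 \partial^1_{\mathrm{CE}}(g)+\Delta^2(f),\ \phi^1(h)-\Delta^2_{\mathrm{Inv}}(f)),$$ with $\Delta^2(f)(x,y)=f(\delta x,y)+f(x,\delta y)-\delta f(x,y)$, $\Delta^2_{\mathrm{Inv}}(f)(x,y)=f(\delta x,\delta y)-\delta^2f(x,y)$, $\phi^1(h)(x,y)=\delta h([x,y]_L)+h(\delta[x,y]_L)-[\delta x,h(y)]_L+[\delta y,h(x)]_L$. *)

theory Defs
  imports "HOL-Computational_Algebra.Formal_Power_Series"
begin

section \<open>InvDer Lie algebras\<close>

definition bilinear_map ::
  "('r::comm_ring_1 \<Rightarrow> 'm::ab_group_add \<Rightarrow> 'm) \<Rightarrow> ('m \<Rightarrow> 'm \<Rightarrow> 'm) \<Rightarrow> bool" where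
  "bilinear_map s b \<longleftrightarrow>
     (\<forall>x. module_hom s s (\<lambda>y. b x y)) \<and> (\<forall>y. module_hom s s (\<lambda>x. b x y))"

locale lie_algebra = vector_space scale
  for scale :: "'k::field_char_0 \<Rightarrow> 'v::ab_group_add \<Rightarrow> 'v" +
  fixes br :: "'v \<Rightarrow> 'v \<Rightarrow> 'v"
  assumes br_bilinear: "bilinear_map scale br"
    and br_alternating: "br x x = 0"
    and br_jacobi: "br x (br y z) + br y (br z x) + br z (br x y) = 0"

locale inv_der_lie_algebra = lie_algebra scale br
  for scale :: "'k::field_char_0 \<Rightarrow> 'v::ab_group_add \<Rightarrow> 'v"
    and br :: "'v \<Rightarrow> 'v \<Rightarrow> 'v" +
  fixes \<delta> :: "'v \<Rightarrow> 'v"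
  assumes der_linear: "Vector_Spaces.linear scale scale \<delta>"
    and der_leibniz: "\<delta> (br x y) = br (\<delta> x) y + br x (\<delta> y)"
    and der_invertible: "bij \<delta>"
    and der_inv: "br (\<delta> x) (\<delta> y) = \<delta> (\<delta> (br x y))"

section \<open>Formal deformations\<close>

text \<open>
  \<open>L[[t]]\<close> is the type \<open>'v fps\<close>, with \<open>L\<close> embedded by \<^const>\<open>fps_const\<close>; it is a module over
  \<open>K[[t]]\<close> by the Cauchy product.
\<close>

definition fps_scale ::
  "('k::comm_ring_1 \<Rightarrow> 'v::ab_group_add \<Rightarrow> 'v) \<Rightarrow> 'k fps \<Rightarrow> 'v fps \<Rightarrow> 'v fps" where
  "fps_scale s a X = Abs_fps (\<lambda>n. \<Sum>i=0..n. s (fps_nth a i) (fps_nth X (n - i)))"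

lemma module_fps_scale:
  assumes "module s"
  shows "module (fps_scale s)"
proof -
  interpret module s by fact
  show ?thesis
  proof
    fix a b :: "'a fps" and X Y :: "'b fps"
    show "fps_scale s a (X + Y) = fps_scale s a X + fps_scale s a Y"
      by (simp add: fps_scale_def fps_eq_iff scale_right_distrib sum.distrib)
    show "fps_scale s (a + b) X = fps_scale s a X + fps_scale s b X"
      by (simp add: fps_scale_def fps_eq_iff scale_left_distrib sum.distrib)
    show "fps_scale s 1 X = X"
    proof (rule fps_ext)
      fix n
      have "(\<Sum>i=0..n. s (fps_nth 1 i) (fps_nth X (n - i))) =
            (\<Sum>i=0..n. if i = 0 then fps_nth X n else 0)"
        by (rule sum.cong) auto
      then show "fps_nth (fps_scale s 1 X) n = fps_nth X n"
        by (simp add: fps_scale_def)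
    qed
    show "fps_scale s a (fps_scale s b X) = fps_scale s (a * b) X"
    proof (rule fps_ext)
      fix n
      have "(\<Sum>j=0..n. \<Sum>i=0..j. s (fps_nth a i * fps_nth b (j - i)) (fps_nth X (n - j))) =
            (\<Sum>j=0..n. \<Sum>i=0..n - j. s (fps_nth a j * fps_nth b i) (fps_nth X (n - j - i)))"
        by (rule fps_mult_assoc_lemma)
      then show "fps_nth (fps_scale s a (fps_scale s b X)) n = fps_nth (fps_scale s (a * b) X) n"
        by (simp add: fps_scale_def fps_mult_nth scale_sum_left scale_sum_right)
    qed
  qed
qed

text \<open>
  A deformation is the pair \<open>(\<mu>t, \<delta>t)\<close>; the families \<open>\<mu>\<close>, \<open>d\<close> are its coefficients.  The expansions
  \<open>\<mu>t = \<Sum>i. \<mu> i t^i\<close> and \<open>\<delta>t = \<Sum>i. d i t^i\<close> are stated on \<open>L\<close>.  A \<open>K[[t]]\<close>-linear map on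
  \<open>L[[t]]\<close> commutes with multiplication by \<open>t^n\<close>, hence is continuous for the \<open>t\<close>-adic topology,
  so the values on \<open>L\<close> determine \<open>\<mu>t\<close> and \<open>\<delta>t\<close>.
\<close>

definition formal_deformation ::
  "('k::field_char_0 \<Rightarrow> 'v::ab_group_add \<Rightarrow> 'v) \<Rightarrow> ('v \<Rightarrow> 'v \<Rightarrow> 'v) \<Rightarrow> ('v \<Rightarrow> 'v) \<Rightarrow>
   ('v fps \<Rightarrow> 'v fps \<Rightarrow> 'v fps) \<Rightarrow> ('v fps \<Rightarrow> 'v fps) \<Rightarrow>
   (nat \<Rightarrow> 'v \<Rightarrow> 'v \<Rightarrow> 'v) \<Rightarrow> (nat \<Rightarrow> 'v \<Rightarrow> 'v) \<Rightarrow> bool" where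
  "formal_deformation scale br \<delta> \<mu>t \<delta>t \<mu> d \<longleftrightarrow>
     bilinear_map (fps_scale scale) \<mu>t \<and>
     module_hom (fps_scale scale) (fps_scale scale) \<delta>t \<and>
     (\<forall>x y. \<mu>t (fps_const x) (fps_const y) = Abs_fps (\<lambda>i. \<mu> i x y)) \<and>
     (\<forall>x. \<delta>t (fps_const x) = Abs_fps (\<lambda>i. d i x)) \<and>
     (\<forall>i. bilinear_map scale (\<mu> i) \<and> (\<forall>x y. \<mu> i x y = - \<mu> i y x)) \<and>
     (\<forall>i. Vector_Spaces.linear scale scale (d i)) \<and>
     \<mu> 0 = br \<and> d 0 = \<delta> \<and>
     (\<forall>a b c. let x = fps_const a; y = fps_const b; z = fps_const c in
        \<mu>t x (\<mu>t y z) + \<mu>t y (\<mu>t z x) + \<mu>t z (\<mu>t x y) = 0 \<and>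
        \<delta>t (\<mu>t x y) - \<mu>t (\<delta>t x) y - \<mu>t x (\<delta>t y) = 0 \<and>
        \<delta>t (\<delta>t (\<mu>t x y)) - \<mu>t (\<delta>t x) (\<delta>t y) = 0)"

section \<open>Cohomology with coefficients in the adjoint representation\<close>

text \<open>
  \<open>Hom(\<Lambda>\<^sup>n L, L)\<close> is the space of alternating \<open>n\<close>-linear maps, taken as functions on
  lists of length \<open>n\<close> and extended by \<open>0\<close> to all other lists, so that equality of cochains
  is equality of functions.
\<close>

definition cochains ::
  "('k::field_char_0 \<Rightarrow> 'v::ab_group_add \<Rightarrow> 'v) \<Rightarrow> nat \<Rightarrow> ('v list \<Rightarrow> 'v) set" where
  "cochains scale n = {f.
     (\<forall>xs i. length xs = n \<and> i < n \<longrightarrow> Vector_Spaces.linear scale scale (\<lambda>x. f (xs[i := x]))) \<and>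
     (\<forall>xs. length xs = n \<and> \<not> distinct xs \<longrightarrow> f xs = 0) \<and>
     (\<forall>xs. length xs \<noteq> n \<longrightarrow> f xs = 0)}"

definition cochain1 :: "('v::zero \<Rightarrow> 'v) \<Rightarrow> 'v list \<Rightarrow> 'v" where
  "cochain1 g = (\<lambda>xs. case xs of [x] \<Rightarrow> g x | _ \<Rightarrow> 0)"

definition cochain2 :: "('v::zero \<Rightarrow> 'v \<Rightarrow> 'v) \<Rightarrow> 'v list \<Rightarrow> 'v" where
  "cochain2 f = (\<lambda>xs. case xs of [x, y] \<Rightarrow> f x y | _ \<Rightarrow> 0)"

text \<open>
  Indices are shifted to start at \<open>0\<close>, so the sign of \<open>[x\<^sub>i, f(\<dots>)]\<close> reads \<open>(-1)^i\<close>;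
  \<open>nths xs (- I)\<close> omits the entries with index in \<open>I\<close>.
\<close>

definition CE_diff ::
  "('k::field_char_0 \<Rightarrow> 'v::ab_group_add \<Rightarrow> 'v) \<Rightarrow> ('v \<Rightarrow> 'v \<Rightarrow> 'v) \<Rightarrow> nat \<Rightarrow>
   ('v list \<Rightarrow> 'v) \<Rightarrow> 'v list \<Rightarrow> 'v" where
  "CE_diff scale br n f = (\<lambda>xs. if length xs = n + 1 then
       (\<Sum>i<n+1. scale ((-1) ^ i) (br (xs ! i) (f (nths xs (- {i}))))) +
       (\<Sum>j<n+1. \<Sum>i<j. scale ((-1) ^ (i + j)) (f (br (xs ! i) (xs ! j) # nths xs (- {i, j}))))
     else 0)"

definition Delta2 ::
  "('v::ab_group_add \<Rightarrow> 'v) \<Rightarrow> ('v list \<Rightarrow> 'v) \<Rightarrow> 'v list \<Rightarrow> 'v" where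
  "Delta2 \<delta> f = cochain2 (\<lambda>x y. f [\<delta> x, y] + f [x, \<delta> y] - \<delta> (f [x, y]))"

definition Delta2_Inv ::
  "('v::ab_group_add \<Rightarrow> 'v) \<Rightarrow> ('v list \<Rightarrow> 'v) \<Rightarrow> 'v list \<Rightarrow> 'v" where
  "Delta2_Inv \<delta> f = cochain2 (\<lambda>x y. f [\<delta> x, \<delta> y] - \<delta> (\<delta> (f [x, y])))"

definition phi1 ::
  "('v::ab_group_add \<Rightarrow> 'v \<Rightarrow> 'v) \<Rightarrow> ('v \<Rightarrow> 'v) \<Rightarrow> ('v list \<Rightarrow> 'v) \<Rightarrow> 'v list \<Rightarrow> 'v" where
  "phi1 br \<delta> h = cochain2 (\<lambda>x y.
     \<delta> (h [br x y]) + h [\<delta> (br x y)] - br (\<delta> x) (h [y]) + br (\<delta> y) (h [x]))"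

definition D2_InvDer ::
  "('k::field_char_0 \<Rightarrow> 'v::ab_group_add \<Rightarrow> 'v) \<Rightarrow> ('v \<Rightarrow> 'v \<Rightarrow> 'v) \<Rightarrow> ('v \<Rightarrow> 'v) \<Rightarrow>
   ('v list \<Rightarrow> 'v) \<times> ('v list \<Rightarrow> 'v) \<times> ('v list \<Rightarrow> 'v) \<Rightarrow>
   ('v list \<Rightarrow> 'v) \<times> ('v list \<Rightarrow> 'v) \<times> ('v list \<Rightarrow> 'v)" where
  "D2_InvDer scale br \<delta> = (\<lambda>(f, g, h).
     (CE_diff scale br 2 f,
      (\<lambda>xs. CE_diff scale br 1 g xs + Delta2 \<delta> f xs),
      (\<lambda>xs. phi1 br \<delta> h xs - Delta2_Inv \<delta> f xs)))"

definition two_cocycles ::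
  "('k::field_char_0 \<Rightarrow> 'v::ab_group_add \<Rightarrow> 'v) \<Rightarrow> ('v \<Rightarrow> 'v \<Rightarrow> 'v) \<Rightarrow> ('v \<Rightarrow> 'v) \<Rightarrow>
   (('v list \<Rightarrow> 'v) \<times> ('v list \<Rightarrow> 'v) \<times> ('v list \<Rightarrow> 'v)) set" where
  "two_cocycles scale br \<delta> =
     {c \<in> cochains scale 2 \<times> cochains scale 1 \<times> cochains scale 1.
        D2_InvDer scale br \<delta> c = ((\<lambda>_. 0), (\<lambda>_. 0), (\<lambda>_. 0))}"

end

theory Submission
  imports Defs
begin

text \<open>
  Writing \<open>X = X\<^sub>0 + t Y\<close> in \<open>L[[t]]\<close>, linearity over \<open>K[[t]]\<close> alone determines the coefficients of
  \<open>t\<^sup>0\<close> and \<open>t\<^sup>1\<close> of \<open>\<delta>t X\<close> and \<open>\<mu>t X Y\<close> from \<open>\<mu> 0\<close>, \<open>\<mu> 1\<close>, \<open>d 0\<close>, \<open>d 1\<close>.  The coefficients of \<open>t\<^sup>1\<close> in the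
  three deformation equations are, up to sign and skew-symmetry, the three components of the
  cocycle condition.
\<close>

lemma fps_nth_fps_scale_X:
  assumes "module s"
  shows "fps_nth (fps_scale s fps_X X) n = (if n = 0 then 0 else fps_nth X (n - 1))"
proof -
  interpret module s by fact
  have "(\<Sum>i=0..n. s (fps_nth fps_X i) (fps_nth X (n - i))) =
        (\<Sum>i=0..n. if i = 1 then fps_nth X (n - 1) else 0)"
    by (rule sum.cong) (auto simp: fps_X_nth)
  then show ?thesis by (simp add: fps_scale_def)
qed

lemma fps_const_plus_X_shift:
  assumes "module s"
  shows "X = fps_const (fps_nth X 0) + fps_scale s fps_X (fps_shift 1 X)"
  by (rule fps_ext) (simp add: fps_nth_fps_scale_X[OF assms])

text \<open>Apply \<open>F\<close> to the splitting of \<open>X\<close> into constant term plus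
  \<open>fps_X\<close> times the shifted series. The factor \<open>fps_X\<close> comes out and moves
  coefficients up by one, so this is a recursion on the degree that avoids infinite sums.\<close>

lemma fps_module_hom_nth:
  assumes s: "module s" and F: "module_hom (fps_scale s) (fps_scale s) F"
  shows "fps_nth (F X) 0 = fps_nth (F (fps_const (fps_nth X 0))) 0"
    and "fps_nth (F X) (Suc n) =
      fps_nth (F (fps_const (fps_nth X 0))) (Suc n) + fps_nth (F (fps_shift 1 X)) n"
proof -
  interpret F: module_hom "fps_scale s" "fps_scale s" F by fact
  have "F X = F (fps_const (fps_nth X 0)) + fps_scale s fps_X (F (fps_shift 1 X))"
    by (subst fps_const_plus_X_shift[OF s, of X]) (simp only: F.add F.scale)
  then show "fps_nth (F X) 0 = fps_nth (F (fps_const (fps_nth X 0))) 0"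
    and "fps_nth (F X) (Suc n) =
      fps_nth (F (fps_const (fps_nth X 0))) (Suc n) + fps_nth (F (fps_shift 1 X)) n"
    by (simp_all add: fps_nth_fps_scale_X[OF s])
qed

lemma fps_linear_nth_0_1:
  assumes "module s" and "module_hom (fps_scale s) (fps_scale s) F"
    and "\<And>x. F (fps_const x) = Abs_fps (\<lambda>i. d i x)"
  shows "fps_nth (F X) 0 = d 0 (fps_nth X 0)"
    and "fps_nth (F X) 1 = d 1 (fps_nth X 0) + d 0 (fps_nth X 1)"
proof -
  \<comment> \<open>Proved for every \<open>X\<close>, since the next coefficient needs it at
    \<open>fps_shift 1 X\<close>, whose constant term is the degree 1 coefficient of
    \<open>X\<close>.\<close>
  show 0: "fps_nth (F X) 0 = d 0 (fps_nth X 0)" for X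
    using fps_module_hom_nth(1)[OF assms(1,2), of X] by (simp add: assms(3))
  show "fps_nth (F X) 1 = d 1 (fps_nth X 0) + d 0 (fps_nth X 1)"
    using fps_module_hom_nth(2)[OF assms(1,2), of X 0] by (simp add: assms(3) 0)
qed

lemma fps_bilinear_nth_0_1:
  assumes s: "module s" and B: "bilinear_map (fps_scale s) B"
    and const: "\<And>x y. B (fps_const x) (fps_const y) = Abs_fps (\<lambda>i. \<mu> i x y)"
  shows "fps_nth (B X Y) 0 = \<mu> 0 (fps_nth X 0) (fps_nth Y 0)"
    and "fps_nth (B X Y) 1 = \<mu> 1 (fps_nth X 0) (fps_nth Y 0) +
      \<mu> 0 (fps_nth X 1) (fps_nth Y 0) + \<mu> 0 (fps_nth X 0) (fps_nth Y 1)"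
proof -
  have l: "module_hom (fps_scale s) (fps_scale s) (\<lambda>x. B x y)"
    and r: "module_hom (fps_scale s) (fps_scale s) (\<lambda>y. B x y)" for x y
    using B by (auto simp: bilinear_map_def)
  \<comment> \<open>The recursion in the left slot leaves a constant there. With that constant
    fixed, \<open>B\<close> is linear in the right slot with coefficients \<open>\<mu> i x\<close>,
    so the linear case applies.\<close>
  note cr = fps_linear_nth_0_1[where d = "\<lambda>i. \<mu> i x" and F = "B (fps_const x)" for x,
    OF s r const]
  show 0: "fps_nth (B X Y) 0 = \<mu> 0 (fps_nth X 0) (fps_nth Y 0)" for X Y
    using fps_module_hom_nth(1)[OF s l, of X Y] by (simp add: cr(1))
  show "fps_nth (B X Y) 1 = \<mu> 1 (fps_nth X 0) (fps_nth Y 0) +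
      \<mu> 0 (fps_nth X 1) (fps_nth Y 0) + \<mu> 0 (fps_nth X 0) (fps_nth Y 1)"
    using fps_module_hom_nth(2)[OF s l, of X Y 0] cr(2)[of "fps_nth X 0" Y] by (simp add: 0)
qed

lemma cochain1_in_cochains:
  fixes scale :: "'k::field_char_0 \<Rightarrow> 'v::ab_group_add \<Rightarrow> 'v"
  assumes "Vector_Spaces.linear scale scale g"
  shows "cochain1 g \<in> cochains scale 1"
  using assms
  by (auto simp: cochains_def cochain1_def length_Suc_conv split: list.splits)

text \<open>Cochains must vanish on repeated entries; skew-symmetry gives only
  \<open>2 f(x,x) = 0\<close>, and characteristic 0 allows division by 2.\<close>

lemma cochain2_in_cochains:
  fixes scale :: "'k::field_char_0 \<Rightarrow> 'v::ab_group_add \<Rightarrow> 'v"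
  assumes "vector_space scale" and "bilinear_map scale f" and skew: "\<And>x y. f x y = - f y x"
  shows "cochain2 f \<in> cochains scale 2"
proof -
  interpret vector_space scale by fact
  have lin: "Vector_Spaces.linear scale scale (f x)"
    "Vector_Spaces.linear scale scale (\<lambda>x. f x y)" for x y
    using assms(1,2) by (auto simp: bilinear_map_def module_hom_iff_linear)
  have "f x x = 0" for x
  proof -
    have "scale 2 (f x x) = f x x + f x x"
      using scale_left_distrib[of 1 1 "f x x"] by simp
    also have "\<dots> = 0" using skew[of x x] by (metis add.right_inverse)
    finally show ?thesis by simp
  qed
  then show ?thesis using lin
    by (auto simp: cochains_def cochain2_def length_Suc_conv numeral_2_eq_2 less_Suc_eq
      split: list.splits)
qed

text \<open>The default value 0 of \<open>cochain2\<close> matches the length guard of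
  \<open>CE_diff\<close>, so the formula holds on all lists and can be used as a rewrite
  rule.\<close>

lemma (in lie_algebra) CE_diff_1:
  "CE_diff scale br 1 (cochain1 g) =
    cochain2 (\<lambda>x y. br x (g y) - br y (g x) - g (br x y))"
  by (rule ext)
    (auto simp: CE_diff_def cochain1_def cochain2_def nths_Cons lessThan_Suc length_Suc_conv
      split: list.splits)

lemma (in lie_algebra) CE_diff_2:
  "CE_diff scale br 2 (cochain2 f) = (\<lambda>xs. case xs of
     [x, y, z] \<Rightarrow> br x (f y z) - br y (f x z) + br z (f x y)
       - f (br x y) z + f (br x z) y - f (br y z) x
   | _ \<Rightarrow> 0)"
  by (rule ext)
    (auto simp: CE_diff_def cochain2_def nths_Cons lessThan_Suc length_Suc_conv
      numeral_2_eq_2 numeral_3_eq_3 split: list.splits)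

theorem theorem5p3:
  fixes scale :: "'k::field_char_0 \<Rightarrow> 'v::ab_group_add \<Rightarrow> 'v"
    and br :: "'v \<Rightarrow> 'v \<Rightarrow> 'v" and \<delta> :: "'v \<Rightarrow> 'v"
    and \<mu>t :: "'v fps \<Rightarrow> 'v fps \<Rightarrow> 'v fps" and \<delta>t :: "'v fps \<Rightarrow> 'v fps"
    and \<mu> :: "nat \<Rightarrow> 'v \<Rightarrow> 'v \<Rightarrow> 'v" and d :: "nat \<Rightarrow> 'v \<Rightarrow> 'v"
  assumes "inv_der_lie_algebra scale br \<delta>"
    and "formal_deformation scale br \<delta> \<mu>t \<delta>t \<mu> d"
  shows "(cochain2 (\<mu> 1), cochain1 (d 1), cochain1 (d 1)) \<in> two_cocycles scale br \<delta>"
proof -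
  interpret inv_der_lie_algebra scale br \<delta> by fact
  note def = assms(2)[unfolded formal_deformation_def Let_def]
  have s: "module scale" by unfold_locales
  have \<mu>t: "bilinear_map (fps_scale scale) \<mu>t"
    and \<delta>t: "module_hom (fps_scale scale) (fps_scale scale) \<delta>t"
    and \<mu>t_const: "\<And>x y. \<mu>t (fps_const x) (fps_const y) = Abs_fps (\<lambda>i. \<mu> i x y)"
    and \<delta>t_const: "\<And>x. \<delta>t (fps_const x) = Abs_fps (\<lambda>i. d i x)"
    and bilin: "\<And>i. bilinear_map scale (\<mu> i)" and skew: "\<And>i x y. \<mu> i x y = - \<mu> i y x"
    and lin: "\<And>i. Vector_Spaces.linear scale scale (d i)"
    and zero: "\<mu> 0 = br" "d 0 = \<delta>"
    using def by blast+
  have jacobi: "\<mu>t (fps_const x) (\<mu>t (fps_const y) (fps_const z)) +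
      \<mu>t (fps_const y) (\<mu>t (fps_const z) (fps_const x)) +
      \<mu>t (fps_const z) (\<mu>t (fps_const x) (fps_const y)) = 0"
    and leibniz: "\<delta>t (\<mu>t (fps_const x) (fps_const y)) - \<mu>t (\<delta>t (fps_const x)) (fps_const y) -
      \<mu>t (fps_const x) (\<delta>t (fps_const y)) = 0"
    and inv: "\<delta>t (\<delta>t (\<mu>t (fps_const x) (fps_const y))) -
      \<mu>t (\<delta>t (fps_const x)) (\<delta>t (fps_const y)) = 0" for x y z
    using def by blast+
  interpret \<delta>: Vector_Spaces.linear scale scale \<delta> by (rule der_linear)
  note \<mu>t_nth = fps_bilinear_nth_0_1[OF s \<mu>t \<mu>t_const, unfolded zero]
  note \<delta>t_nth = fps_linear_nth_0_1[OF s \<delta>t \<delta>t_const, unfolded zero]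
  \<comment> \<open>A constant series has degree 1 coefficient 0, so brackets with 0 appear in the
    expansions below.\<close>
  have br_0: "br x 0 = 0" "br 0 x = 0" for x
    using br_bilinear by (auto simp: bilinear_map_def dest!: spec[of _ x] module_hom.zero)
  note nths = \<mu>t_nth \<delta>t_nth br_0
  have br_skew: "br x y = - br y x" for x y
    using skew[of 0 x y] by (simp add: zero)
  have jacobi_1: "\<mu> 1 x (br y z) + br x (\<mu> 1 y z) + (\<mu> 1 y (br z x) + br y (\<mu> 1 z x)) +
      (\<mu> 1 z (br x y) + br z (\<mu> 1 x y)) = 0" for x y z
    \<comment> \<open>\<open>One_nat_def\<close> is removed so that the index stays in the form used
      by the coefficient lemmas.\<close>
    using arg_cong[OF jacobi[of x y z], of "\<lambda>X. fps_nth X 1"] by (simp add: nths del: One_nat_def)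
  have leibniz_1: "d 1 (br x y) + \<delta> (\<mu> 1 x y) - (\<mu> 1 (\<delta> x) y + br (d 1 x) y) -
      (\<mu> 1 x (\<delta> y) + br x (d 1 y)) = 0" for x y
    using arg_cong[OF leibniz[of x y], of "\<lambda>X. fps_nth X 1"] by (simp add: nths del: One_nat_def)
  have inv_1: "d 1 (\<delta> (br x y)) + (\<delta> (d 1 (br x y)) + \<delta> (\<delta> (\<mu> 1 x y))) -
      (\<mu> 1 (\<delta> x) (\<delta> y) + br (d 1 x) (\<delta> y) + br (\<delta> x) (d 1 y)) = 0" for x y
    using arg_cong[OF inv[of x y], of "\<lambda>X. fps_nth X 1"]
    by (simp add: nths \<delta>.add del: One_nat_def)
  have minus: "\<mu> i x (- y) = - \<mu> i x y" "\<mu> i (- x) y = - \<mu> i x y" for i x y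
    using bilin[of i] by (auto simp: bilinear_map_def intro: module_hom.neg)
  \<comment> \<open>The Jacobi identity is cyclic, whereas the differential lists its arguments in
    increasing order; skew-symmetry of \<open>\<mu> 1\<close> and \<open>br\<close> converts one
    into the other.\<close>
  have CE_2: "br x (\<mu> 1 y z) - br y (\<mu> 1 x z) + br z (\<mu> 1 x y) - \<mu> 1 (br x y) z +
      \<mu> 1 (br x z) y - \<mu> 1 (br y z) x = 0" for x y z
  proof -
    have "\<mu> 1 y (br z x) = \<mu> 1 (br x z) y"
      by (subst skew, subst br_skew) (simp add: minus)
    moreover have "br y (\<mu> 1 z x) = - br y (\<mu> 1 x z)"
      \<comment> \<open>Folding \<open>br\<close> back to \<open>\<mu> 0\<close> makes
        \<open>minus\<close> apply to the bracket.\<close>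
      by (subst skew) (simp add: minus flip: zero)
    ultimately show ?thesis
      using jacobi_1[of x y z] skew[of 1 x "br y z"] skew[of 1 z "br x y"]
      by (simp add: algebra_simps)
  qed
  \<comment> \<open>This is the negative of \<open>leibniz_1\<close>, with one bracket
    reversed.\<close>
  have CE_1: "br x (d 1 y) - br y (d 1 x) - d 1 (br x y) +
      (\<mu> 1 (\<delta> x) y + \<mu> 1 x (\<delta> y) - \<delta> (\<mu> 1 x y)) = 0" for x y
    using leibniz_1[of x y] br_skew[of "d 1 x" y] by (simp add: algebra_simps)
  \<comment> \<open>The two mixed terms of degree 1 in the square of \<open>\<delta>t\<close> form
    the part of \<open>phi1\<close> containing \<open>\<delta>\<close>-composites of
    \<open>d 1\<close>, which is why the third component is \<open>d 1\<close> again.\<close>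
  have phi: "\<delta> (d 1 (br x y)) + d 1 (\<delta> (br x y)) - br (\<delta> x) (d 1 y) + br (\<delta> y) (d 1 x) -
      (\<mu> 1 (\<delta> x) (\<delta> y) - \<delta> (\<delta> (\<mu> 1 x y))) = 0" for x y
    using inv_1[of x y] br_skew[of "d 1 x" "\<delta> y"] by (simp add: algebra_simps)
  have "D2_InvDer scale br \<delta> (cochain2 (\<mu> 1), cochain1 (d 1), cochain1 (d 1)) =
      ((\<lambda>_. 0), (\<lambda>_. 0), (\<lambda>_. 0))"
    unfolding D2_InvDer_def prod.case CE_diff_1 CE_diff_2 phi1_def Delta2_def Delta2_Inv_def
    using CE_2 CE_1 phi
    by (auto simp: fun_eq_iff cochain1_def cochain2_def split: list.splits)
  moreover have "cochain2 (\<mu> 1) \<in> cochains scale 2"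
    by (rule cochain2_in_cochains[OF vector_space_axioms bilin skew])
  moreover have "cochain1 (d 1) \<in> cochains scale 1"
    by (rule cochain1_in_cochains[OF lin])
  ultimately show ?thesis by (simp add: two_cocycles_def)
qed

end
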